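(* Let $k\ge1$, $d>0$, let $x^e\in\mathcal T_d(k)$, and put $i=i(e)$. Row $e$ of $\overline M(k,d)$ is zero if and only if either $x^e$ is a spike, or the following holds: $e_i=1$, exactly one index $j>i$ has $e_j=2$, and $e_\ell$ is a spike exponent (i.e. of the form $2^m-1$ with $m\ge0$) for every $\ell\notin\{i,j\}$. Consequently, the number $z(k,d)$ of zero rows of $\overline M(k,d)$ is $$z(k,d)=\mathcal S_k(d)+\sum_{r=0}^{k-2}(r+1)\,\mathcal S_r(d-3),$$ where the sum is empty for $k=1$.
   Context: $\mathbb N$ includes $0$. $\mathcal P_k=\mathbb F_2[x_1,\dots,x_k]$ with $\deg x_i=1$; $\mathcal P_k^n$ is the degree-$n$ part. For $e\in\mathbb N^k$, $x^e=\prod x_i^{e_i}$, $|e|=\sum e_i$; $\varepsilon_i$ is the $i$th standard vector. Steenrod squares act linearly by $\mathrm{Sq}^r(x^a)=\sum_{b\in\mathbb N^k,|b|=r}\prod_i\binom{a_i}{b_i}x^{a+b}$ (mod 2). For $e\neq0$ put $i(e)=\min\{i:e_i>0\}$. The linear map $h$ is given by $h(x^e)=x^{e-\varepsilon_{i(e)}}$ if $e_{i(e)}$ is even, $h(x^e)=0$ if $e_{i(e)}$ is odd, and $h(1)=0$. For $d>0$, $p_d=h\,\mathrm{Sq}^1:\mathcal P_k^d\to\mathcal P_k^d$, and $\mathcal T_d(k)$ is the set of degree-$d$ monomials $x^e$ with $e_{i(e)}$ odd; the image of $p_d$ is the span of $\mathcal T_d(k)$. $\overline M(k,d)$ is the matrix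 with row basis $\mathcal T_d(k)$ and labelled columns $p_d\mathrm{Sq}^{2^t}(g)$ for $t\ge1$, $2^t\le d$, $g$ a monomial of degree $d-2^t$. A monomial $x^b$ is a spike if each $b_i=2^{m_i}-1$ for an integer $m_i\ge0$ (zero exponents allowed). $\mathcal S_k(d)$ is the number of spikes of degree $d$ in $k$ variables; conventions: $\mathcal S_0(0)=1$, $\mathcal S_0(d)=0$ for $d\ne0$, and $\mathcal S_k(d)=0$ for every $k\ge0$ and $d<0$. *)

theory Defs
  imports "HOL-Library.Poly_Mapping" "HOL-Library.Z2"
begin

(* The variables are x_1, x_2, ...; an exponent vector is a finitely supported function on the
   indices, and a polynomial over F_2 (= bit) is a finitely supported function on the exponent
   vectors, with the convolution product of Poly_Mapping. *)
type_synonym expo = "nat \<Rightarrow>\<^sub>0 nat"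
type_synonym pol = "expo \<Rightarrow>\<^sub>0 bit"

definition expos :: "nat \<Rightarrow> nat \<Rightarrow> expo set" where
  "expos k n = {e. Poly_Mapping.keys e \<subseteq> {1..k} \<and> (\<Sum>i\<in>{1..k}. Poly_Mapping.lookup e i) = n}"

definition xpow :: "expo \<Rightarrow> pol" where
  "xpow e = Poly_Mapping.single e 1"

(* linear extension of a map given on monomials; the factor single 0 c is the constant c *)
definition lin_ext :: "(expo \<Rightarrow> pol) \<Rightarrow> pol \<Rightarrow> pol" where
  "lin_ext \<phi> f = (\<Sum>a\<in>Poly_Mapping.keys f. Poly_Mapping.single 0 (Poly_Mapping.lookup f a) * \<phi> a)"

definition Sq :: "nat \<Rightarrow> nat \<Rightarrow> pol \<Rightarrow> pol" where
  "Sq k r = lin_ext (\<lambda>a. \<Sum>b\<in>expos k r.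
      Poly_Mapping.single 0 (of_nat (\<Prod>i\<in>{1..k}. Poly_Mapping.lookup a i choose Poly_Mapping.lookup b i)) * xpow (a + b))"

(* i(e), only meaningful for e \<noteq> 0 *)
definition lead_index :: "expo \<Rightarrow> nat" where
  "lead_index e = (LEAST i. Poly_Mapping.lookup e i > 0)"

definition h :: "pol \<Rightarrow> pol" where
  "h = lin_ext (\<lambda>e. if e \<noteq> 0 \<and> even (Poly_Mapping.lookup e (lead_index e))
                    then xpow (e - Poly_Mapping.single (lead_index e) 1) else 0)"

(* the maps p_d are the restrictions of this map to the homogeneous parts of degree d > 0 *)
definition p :: "nat \<Rightarrow> pol \<Rightarrow> pol" where
  "p k f = h (Sq k 1 f)"

(* monomials are represented by their exponent vectors *)
definition T :: "nat \<Rightarrow> nat \<Rightarrow> expo set" where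
  "T k d = {e \<in> expos k d. e \<noteq> 0 \<and> odd (Poly_Mapping.lookup e (lead_index e))}"

definition col_labels :: "nat \<Rightarrow> nat \<Rightarrow> (nat \<times> expo) set" where
  "col_labels k d = {(t, g). t \<ge> 1 \<and> 2 ^ t \<le> d \<and> g \<in> expos k (d - 2 ^ t)}"

(* The columns are expanded in the basis T k d of the image of p_d, so the entry in row e is the
   coefficient of x^e. The degree d enters only through the index sets T k d and col_labels k d. *)
definition M_entry :: "nat \<Rightarrow> expo \<Rightarrow> nat \<times> expo \<Rightarrow> bit" where
  "M_entry k e = (\<lambda>(t, g). Poly_Mapping.lookup (p k (Sq k (2 ^ t) (xpow g))) e)"

definition zero_row :: "nat \<Rightarrow> nat \<Rightarrow> expo \<Rightarrow> bool" where
  "zero_row k d e \<longleftrightarrow> (\<forall>c\<in>col_labels k d. M_entry k e c = 0)"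

definition z :: "nat \<Rightarrow> nat \<Rightarrow> nat" where
  "z k d = card {e \<in> T k d. zero_row k d e}"

definition spike_exponent :: "nat \<Rightarrow> bool" where
  "spike_exponent n \<longleftrightarrow> (\<exists>m::nat. n = 2 ^ m - 1)"

definition spike :: "nat \<Rightarrow> expo \<Rightarrow> bool" where
  "spike k b \<longleftrightarrow> (\<forall>i\<in>{1..k}. spike_exponent (Poly_Mapping.lookup b i))"

(* The degree is an integer; the conventions for k = 0 and for d < 0 are instances of this
   definition. *)
definition S :: "nat \<Rightarrow> int \<Rightarrow> nat" where
  "S k d = card {b. \<exists>n. int n = d \<and> b \<in> expos k n \<and> spike k b}"

end

theory Submission
  imports Defs "HOL-Library.FuncSet"
begin

text \<open>
  Let \<open>x\<^sup>e\<close> be a row, so that the leading exponent \<open>e\<^sub>i\<close> is odd, and put \<open>c = e + \<epsilon>\<^sub>i\<close>. The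
  only monomial that \<open>h\<close> sends to \<open>x\<^sup>e\<close> is \<open>x\<^sup>c\<close> (\<open>lookup_h\<close>), and \<open>Sq\<^sup>1\<close> produces \<open>x\<^sup>c\<close> exactly from
  the monomials \<open>x\<^bsup>c - \<epsilon>\<^sub>j\<^esup>\<close> with \<open>c\<^sub>j\<close> even and positive (\<open>lookup_Sq_1\<close>). Hence the entry of row \<open>e\<close>
  in column \<open>(t, g)\<close> is the parity of the number of such \<open>j\<close> for which \<open>x\<^bsup>c - \<epsilon>\<^sub>j\<^esup>\<close> occurs in
  \<open>Sq\<^bsup>2^t\<^esup> x\<^sup>g\<close> (\<open>M_entry_eq\<close>). That condition splits over the variables: each exponent \<open>a\<close> has to be
  hit by the exponent \<open>g\<close> below it, meaning that the binomial coefficient of \<open>g\<close> over \<open>a - g\<close> is odd.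

  By Lucas' theorem modulo 2, a spike exponent is hit only by itself, while every other
  exponent \<open>a\<close> is hit by some \<open>a - 2^t\<close>; here \<open>t \<ge> 1\<close> if \<open>a\<close> is odd.

  If \<open>x\<^sup>e\<close> is a spike, or a spike except for one exponent 2 as in the theorem, then each
  \<open>c - \<epsilon>\<^sub>j\<close> in question has spike exponents with at most one exception, which equals 2. A
  monomial hitting it has degree smaller by at most 1, but the columns lower the degree by
  \<open>2^t \<ge> 2\<close>; so the row is zero (\<open>zero_row_of_almost_spikes\<close>).

  Conversely, the columns \<open>g = c - \<epsilon>\<^sub>j - 2^t \<epsilon>\<^sub>l\<close> with \<open>t \<ge> 1\<close> see no contributor but possibly \<open>j\<close>
  (\<open>isolated_column\<close>). If the row is zero, these columns force \<open>c\<^sub>l\<close> to be a spike exponent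
  wherever it is odd, \<open>c\<^sub>j\<close> to be a power of 2 wherever it is even and positive, and all even
  positive \<open>c\<^sub>j\<close> to be 2 as soon as there are two of them. Three exponents 2 are excluded by the column
  that lowers all three by one, where exactly three terms contribute (\<open>no_three_twos\<close>).

  For the count, removing the exponents 1 and 2 at positions \<open>i < j\<close> leaves a spike of
  degree \<open>d - 3\<close> in the \<open>r = k - i - 1\<close> remaining variables after \<open>x\<^sub>i\<close>, and there are \<open>k - i = r + 1\<close>
  choices of \<open>j\<close>.
\<close>

section \<open>Coefficients of the linear maps\<close>

text \<open>
  The simplifier normally turns the field operations of \<^typ>\<open>bit\<close> into bitwise ones, which hides
  them from the algebraic rewrite rules.
\<close>

declare add_bit_eq_xor [simp del] mult_bit_eq_and [simp del]

lemma of_nat_bit_eq_odd: "(of_nat n :: bit) = of_bool (odd n)"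
proof (induction n)
  case (Suc n)
  then show ?case by (cases "even n") simp_all
qed simp

lemma lookup_const_mult:
  fixes q :: pol
  shows "Poly_Mapping.lookup (Poly_Mapping.single 0 c * q) a = c * Poly_Mapping.lookup q a"
  by (simp flip: mult_map_scale_conv_mult add: map.rep_eq when_def)

lemma lookup_lin_ext:
  "Poly_Mapping.lookup (lin_ext \<phi> f) e =
     (\<Sum>a\<in>Poly_Mapping.keys f. Poly_Mapping.lookup f a * Poly_Mapping.lookup (\<phi> a) e)"
  by (simp add: lin_ext_def lookup_sum lookup_const_mult)

lemma lookup_xpow: "Poly_Mapping.lookup (xpow a) e = of_bool (a = e)"
  by (simp add: xpow_def lookup_single when_def)

lemma expos_support:
  assumes "e \<in> expos k n" and "Poly_Mapping.lookup e l \<noteq> 0"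
  shows "l \<in> {1..k}"
proof -
  have "l \<in> Poly_Mapping.keys e"
    using assms(2) by (simp add: in_keys_iff)
  then show ?thesis
    using assms(1) by (auto simp: expos_def)
qed

lemma finite_expos: "finite (expos k n)"
proof -
  have "Poly_Mapping.lookup e i \<le> n" if "e \<in> expos k n" "i \<in> {1..k}" for e i
    using that member_le_sum[of i "{1..k}" "Poly_Mapping.lookup e"] by (auto simp: expos_def)
  moreover have "Poly_Mapping.lookup e i = 0" if "e \<in> expos k n" "i \<notin> {1..k}" for e i
    using that(2) expos_support[OF that(1)] by blast
  ultimately have "Poly_Mapping.lookup ` expos k n \<subseteq>
      {f. \<forall>i. (i \<in> {1..k} \<longrightarrow> f i \<in> {..n}) \<and> (i \<notin> {1..k} \<longrightarrow> f i = 0)}"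
    by (simp add: image_subset_iff)
  moreover have "finite {f :: nat \<Rightarrow> nat. \<forall>i. (i \<in> {1..k} \<longrightarrow> f i \<in> {..n}) \<and> (i \<notin> {1..k} \<longrightarrow> f i = 0)}"
    by (rule finite_set_of_finite_funs) auto
  ultimately have "finite (Poly_Mapping.lookup ` expos k n)"
    by (rule finite_subset)
  moreover have "inj_on Poly_Mapping.lookup (expos k n)"
    by (auto intro!: inj_onI poly_mapping_eqI)
  ultimately show ?thesis
    by (simp add: finite_image_iff)
qed

lemma lead_index_cong:
  assumes "\<And>l. Poly_Mapping.lookup a l > 0 \<longleftrightarrow> Poly_Mapping.lookup b l > 0"
  shows "lead_index a = lead_index b"
  using assms by (simp add: lead_index_def)

lemma lead_index_pos:
  assumes "e \<noteq> 0"
  shows "Poly_Mapping.lookup e (lead_index e) > 0"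
proof -
  obtain i where "Poly_Mapping.lookup e i > 0"
    using assms by (metis lookup_zero neq0_conv poly_mapping_eqI)
  then show ?thesis
    unfolding lead_index_def by (rule LeastI)
qed

text \<open>
  If \<open>h\<close> sends \<open>x\<^sup>a\<close> to \<open>x\<^sup>e\<close>, then \<open>a\<close> has a positive even leading exponent, so lowering it by one
  keeps it positive and does not move the leading index. Thus \<open>a\<close> is recovered from \<open>e\<close>.
\<close>

lemma lookup_h:
  assumes "e \<noteq> 0" and "odd (Poly_Mapping.lookup e (lead_index e))"
  shows "Poly_Mapping.lookup (h f) e =
     Poly_Mapping.lookup f (e + Poly_Mapping.single (lead_index e) 1)"
proof -
  define c where "c = e + Poly_Mapping.single (lead_index e) 1"
  have c_lookup: "Poly_Mapping.lookup c l = Poly_Mapping.lookup e l + (if l = lead_index e then 1 else 0)" for l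
    by (simp add: c_def lookup_add lookup_single when_def)
  have lead_c: "lead_index c = lead_index e"
    using lead_index_pos[OF assms(1)] by (intro lead_index_cong) (auto simp: c_lookup)
  have preimage: "(a \<noteq> 0 \<and> even (Poly_Mapping.lookup a (lead_index a)) \<and>
      a - Poly_Mapping.single (lead_index a) 1 = e) \<longleftrightarrow> a = c" for a
  proof
    assume a: "a \<noteq> 0 \<and> even (Poly_Mapping.lookup a (lead_index a)) \<and>
      a - Poly_Mapping.single (lead_index a) 1 = e"
    define i where "i = lead_index a"
    have "Poly_Mapping.lookup a i > 0" "even (Poly_Mapping.lookup a i)"
      using a lead_index_pos[of a] by (auto simp: i_def)
    then have ge2: "Poly_Mapping.lookup a i \<ge> 2"
      by (cases "Poly_Mapping.lookup a i" rule: nat.exhaust) (auto elim: oddE)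
    have e_lookup: "Poly_Mapping.lookup e l = Poly_Mapping.lookup a l - (if l = i then 1 else 0)" for l
      using a by (auto simp: i_def lookup_minus lookup_single when_def)
    have "lead_index e = i"
      unfolding i_def by (rule lead_index_cong) (use ge2 in \<open>auto simp: e_lookup\<close>)
    then show "a = c"
      using ge2 by (intro poly_mapping_eqI) (simp add: c_lookup e_lookup)
  next
    assume "a = c"
    moreover have "Poly_Mapping.lookup c (lead_index e) \<noteq> 0"
      by (simp add: c_lookup)
    then have "c \<noteq> 0"
      by auto
    ultimately show "a \<noteq> 0 \<and> even (Poly_Mapping.lookup a (lead_index a)) \<and>
      a - Poly_Mapping.single (lead_index a) 1 = e"
      using assms(2) by (simp add: lead_c c_lookup) (simp add: c_def)
  qed
  have "Poly_Mapping.lookup (h f) e =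
      (\<Sum>a\<in>Poly_Mapping.keys f. Poly_Mapping.lookup f a * of_bool (a = c))"
    unfolding h_def lookup_lin_ext preimage[symmetric]
    by (intro sum.cong refl arg_cong2[where f = "(*)"]) (auto simp: lookup_xpow)
  also have "\<dots> = (\<Sum>a\<in>Poly_Mapping.keys f. if a = c then Poly_Mapping.lookup f c else 0)"
    by (intro sum.cong) auto
  also have "\<dots> = Poly_Mapping.lookup f c"
    by (simp add: in_keys_iff)
  finally show ?thesis by (simp add: c_def)
qed

lemma lookup_Sq:
  "Poly_Mapping.lookup (Sq k r f) c = (\<Sum>a\<in>Poly_Mapping.keys f. Poly_Mapping.lookup f a *
     of_bool (\<exists>b\<in>expos k r. c = a + b \<and>
       (\<forall>i\<in>{1..k}. odd (Poly_Mapping.lookup a i choose Poly_Mapping.lookup b i))))"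
proof -
  have "Poly_Mapping.lookup (\<Sum>b\<in>expos k r.
      Poly_Mapping.single 0 (of_nat (\<Prod>i\<in>{1..k}. Poly_Mapping.lookup a i choose Poly_Mapping.lookup b i)) * xpow (a + b)) c
     = of_bool (\<exists>b\<in>expos k r. c = a + b \<and>
       (\<forall>i\<in>{1..k}. odd (Poly_Mapping.lookup a i choose Poly_Mapping.lookup b i)))" (is "?l = ?r") for a
  proof -
    have "?l = (\<Sum>b\<in>expos k r. if b = c - a then of_bool (c = a + b \<and>
       (\<forall>i\<in>{1..k}. odd (Poly_Mapping.lookup a i choose Poly_Mapping.lookup b i))) else 0)"
      unfolding lookup_sum lookup_const_mult lookup_xpow of_nat_bit_eq_odd
      by (intro sum.cong) (auto simp: even_prod_iff)
    also have "\<dots> = ?r"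
      by (auto simp: finite_expos)
    finally show ?thesis .
  qed
  then show ?thesis
    unfolding Sq_def lookup_lin_ext by simp
qed

lemma expos_1: "expos k 1 = (\<lambda>j. Poly_Mapping.single j 1) ` {1..k}"
proof (intro equalityI subsetI)
  fix b assume "b \<in> expos k 1"
  then have keys: "Poly_Mapping.keys b \<subseteq> {1..k}"
    and "(\<Sum>i\<in>{1..k}. Poly_Mapping.lookup b i) = 1"
    by (auto simp: expos_def)
  then obtain j where j: "j \<in> {1..k}" "Poly_Mapping.lookup b j = 1"
    "\<And>l. l \<in> {1..k} \<Longrightarrow> j \<noteq> l \<Longrightarrow> Poly_Mapping.lookup b l = 0"
    using sum_eq_1_iff[of "{1..k}" "Poly_Mapping.lookup b"] by blast
  have "b = Poly_Mapping.single j 1"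
  proof (rule poly_mapping_eqI)
    fix l show "Poly_Mapping.lookup b l = Poly_Mapping.lookup (Poly_Mapping.single j 1) l"
      using keys j by (cases "l \<in> {1..k}") (auto simp: lookup_single when_def in_keys_iff)
  qed
  with j show "b \<in> (\<lambda>j. Poly_Mapping.single j 1) ` {1..k}" by blast
next
  fix b assume "b \<in> (\<lambda>j. Poly_Mapping.single j (1::nat)) ` {1..k}"
  then show "b \<in> expos k 1"
    by (auto simp: expos_def lookup_single when_def)
qed

text \<open>
  \<open>Sq\<^sup>1\<close> raises the \<open>j\<close>-th exponent \<open>a\<^sub>j\<close> by one with coefficient \<open>a\<^sub>j\<close>, which is odd precisely when
  the resulting exponent is even and positive.
\<close>

lemma lookup_Sq_1:
  "Poly_Mapping.lookup (Sq k 1 f) c =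
     (\<Sum>j | j \<in> {1..k} \<and> even (Poly_Mapping.lookup c j) \<and> Poly_Mapping.lookup c j > 0.
        Poly_Mapping.lookup f (c - Poly_Mapping.single j 1))"
    (is "_ = (\<Sum>j | ?E j. _)")
proof -
  let ?m = "\<lambda>j. c - Poly_Mapping.single j 1"
  have inj: "inj_on ?m {j. ?E j}"
  proof (rule inj_onI)
    fix j j' assume *: "j \<in> {j. ?E j}" "j' \<in> {j. ?E j}" "?m j = ?m j'"
    from *(3) have "Poly_Mapping.lookup (?m j) j = Poly_Mapping.lookup (?m j') j" by (rule arg_cong)
    moreover have "Poly_Mapping.lookup c j > 0" using *(1) by simp
    ultimately show "j = j'"
      by (simp add: lookup_minus lookup_single when_def split: if_splits)
  qed
  have occurs: "(\<exists>b\<in>expos k 1. c = a + b \<and>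
       (\<forall>i\<in>{1..k}. odd (Poly_Mapping.lookup a i choose Poly_Mapping.lookup b i)))
     \<longleftrightarrow> a \<in> ?m ` {j. ?E j}" for a
  proof
    assume "\<exists>b\<in>expos k 1. c = a + b \<and>
       (\<forall>i\<in>{1..k}. odd (Poly_Mapping.lookup a i choose Poly_Mapping.lookup b i))"
    then obtain j where j: "j \<in> {1..k}" "c = a + Poly_Mapping.single j 1"
      "odd (Poly_Mapping.lookup a j choose 1)"
      unfolding expos_1 by fastforce
    then show "a \<in> ?m ` {j. ?E j}"
      by (intro image_eqI[of _ _ j]) (auto simp: lookup_add)
  next
    assume "a \<in> ?m ` {j. ?E j}"
    then obtain j where j: "?E j" "a = ?m j" by blast
    have "c = a + Poly_Mapping.single j 1"
      using j by (intro poly_mapping_eqI) (auto simp: lookup_add lookup_minus lookup_single when_def)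
    moreover have "odd (Poly_Mapping.lookup a i choose Poly_Mapping.lookup (Poly_Mapping.single j 1) i)" for i
      using j by (auto simp: lookup_minus lookup_single when_def)
    ultimately show "\<exists>b\<in>expos k 1. c = a + b \<and>
       (\<forall>i\<in>{1..k}. odd (Poly_Mapping.lookup a i choose Poly_Mapping.lookup b i))"
      using j unfolding expos_1 by blast
  qed
  have "Poly_Mapping.lookup (Sq k 1 f) c =
      (\<Sum>a\<in>Poly_Mapping.keys f. Poly_Mapping.lookup f a * of_bool (a \<in> ?m ` {j. ?E j}))"
    by (simp only: lookup_Sq occurs)
  also have "\<dots> = (\<Sum>a\<in>?m ` {j. ?E j}. Poly_Mapping.lookup f a)"
    by (rule sum.mono_neutral_cong) (auto simp: in_keys_iff)
  also have "\<dots> = (\<Sum>j | ?E j. Poly_Mapping.lookup f (?m j))"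
    by (simp only: sum.reindex[OF inj] o_def)
  finally show ?thesis .
qed


section \<open>Binomial coefficients modulo 2 and spike exponents\<close>

text \<open>
  Lucas' theorem modulo 2 for an even upper argument. Two applications of Pascal's rule
  give the step, because the middle term is doubled.
\<close>

lemma odd_choose_double:
  "odd ((2 * n) choose (2 * k)) \<longleftrightarrow> odd (n choose k)"
  "even ((2 * n) choose (2 * k + 1))"
proof (induction n arbitrary: k)
  case 0
  {
    case 1
    show ?case by (cases k) auto
  next
    case 2
    show ?case by simp
  }
next
  case (Suc n)
  {
    case 1
    show ?case
    proof (cases k)
      case (Suc k')
      have eq: "(2 * Suc n choose 2 * k) =
          (2 * n choose 2 * k') + 2 * (2 * n choose (2 * k' + 1)) + (2 * n choose (2 * Suc k'))"
        by (simp add: Suc)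
      then show ?thesis
        unfolding eq using Suc.IH(1)[of k'] Suc.IH(1)[of "Suc k'"] Suc by simp
    qed simp
  next
    case 2
    show ?case
    proof (cases k)
      case 0
      then show ?thesis by simp
    next
      case (Suc k')
      have eq: "(2 * Suc n choose (2 * k + 1)) =
          (2 * n choose (2 * k' + 1)) + 2 * (2 * n choose (2 * k)) + (2 * n choose (2 * k + 1))"
        by (simp add: Suc)
      then show ?thesis
        unfolding eq using Suc.IH(2)[of k'] Suc.IH(2)[of k] by simp
    qed
  }
qed

lemma odd_choose_Suc_double:
  "odd ((2 * n + 1) choose (2 * k)) \<longleftrightarrow> odd (n choose k)"
proof (cases k)
  case (Suc k')
  then show ?thesis
    using odd_choose_double(1)[of n k] odd_choose_double(2)[of n k'] by simp
qed simp

text \<open>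
  In one variable, \<open>x\<^sup>a\<close> occurs in the total Steenrod square of \<open>x\<^sup>g\<close>. The condition \<open>g \<le> a\<close> is
  explicit because truncated subtraction would otherwise make every \<open>g > a\<close> hit \<open>a\<close>.
\<close>

definition sq_hits :: "nat \<Rightarrow> nat \<Rightarrow> bool" where
  "sq_hits g a \<longleftrightarrow> g \<le> a \<and> odd (g choose (a - g))"

lemma sq_hits_refl [simp]: "sq_hits a a"
  by (simp add: sq_hits_def)

lemma sq_hits_even_even: "sq_hits (2 * g) (2 * a) \<longleftrightarrow> sq_hits g a"
  using odd_choose_double(1)[of g "a - g"] by (auto simp: sq_hits_def algebra_simps)

lemma sq_hits_odd_odd: "sq_hits (2 * g + 1) (2 * a + 1) \<longleftrightarrow> sq_hits g a"
  using odd_choose_Suc_double[of g "a - g"] by (auto simp: sq_hits_def algebra_simps)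

lemma not_sq_hits_even_odd:
  assumes "even g" and "odd a"
  shows "\<not> sq_hits g a"
proof
  assume "sq_hits g a"
  then have le: "g \<le> a" and odd: "odd (g choose (a - g))"
    by (auto simp: sq_hits_def)
  obtain n where n: "g = 2 * n"
    using assms(1) by (elim evenE)
  obtain k where k: "a - g = 2 * k + 1"
    using assms le oddE[of "a - g"] by auto
  show False
    using odd odd_choose_double(2)[of n k] unfolding k[symmetric] n[symmetric] by blast
qed

text \<open>
  Spike exponents are those with all binary digits equal to 1. Their lowest digit forces
  \<open>g\<close> to be odd, and dropping this digit on both sides leaves the same situation.
\<close>

lemma sq_hits_spike:
  assumes "sq_hits g a" and "spike_exponent a"
  shows "g = a"
proof -
  obtain m where "a = 2 ^ m - 1"
    using assms(2) unfolding spike_exponent_def by blast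
  with assms(1) show ?thesis
  proof (induction m arbitrary: g a)
    case 0
    then show ?case by (simp add: sq_hits_def)
  next
    case (Suc m)
    have a: "a = 2 * (2 ^ m - 1) + 1"
      using Suc.prems(2) one_le_power[of "2::nat" m] unfolding power_Suc by linarith
    have "odd g"
      using Suc.prems(1) not_sq_hits_even_odd[of g a] a by auto
    then obtain g' where g': "g = 2 * g' + 1" by (elim oddE)
    have "sq_hits g' (2 ^ m - 1)"
      using Suc.prems(1) unfolding a g' sq_hits_odd_odd .
    then show ?case
      using Suc.IH g' a by auto
  qed
qed

lemma spike_exponent_double:
  assumes "spike_exponent a"
  shows "spike_exponent (2 * a + 1)"
proof -
  obtain m where "a = 2 ^ m - 1"
    using assms by (auto simp: spike_exponent_def)
  then have "a + 1 = 2 ^ m" by simp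
  then have "2 * a + 1 = 2 ^ Suc m - 1" by simp
  then show ?thesis unfolding spike_exponent_def by blast
qed

lemma spike_exponent_0_1 [simp]:
  "spike_exponent 0" "spike_exponent (Suc 0)"
proof -
  show "spike_exponent 0"
    unfolding spike_exponent_def by (rule exI[of _ 0]) simp
  then show "spike_exponent (Suc 0)"
    using spike_exponent_double[of 0] by simp
qed

lemma odd_spike_exponent:
  assumes "spike_exponent n" and "n > 0"
  shows "odd n"
proof -
  obtain m where "n = 2 ^ m - 1"
    using assms(1) by (auto simp: spike_exponent_def)
  with assms(2) show ?thesis by (cases m) auto
qed

text \<open>
  The power \<open>2^t\<close> can be taken at the lowest binary digit 0 of \<open>a\<close> that has a digit 1 above it;
  the induction strips digits 1 until that position is reached.
\<close>

lemma exists_sq_hit: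
  assumes "\<not> spike_exponent a"
  shows "\<exists>t. 2 ^ t \<le> a \<and> sq_hits (a - 2 ^ t) a \<and> (odd a \<longrightarrow> t \<ge> 1)"
  using assms
proof (induction a rule: less_induct)
  case (less a)
  show ?case
  proof (cases "even a")
    case True
    have "a > 0"
      using less.prems by (cases a) auto
    then have "sq_hits (a - 2 ^ 0) a"
      using True by (auto simp: sq_hits_def)
    with True \<open>a > 0\<close> show ?thesis
      by (intro exI[of _ 0]) auto
  next
    case False
    then obtain a' where a': "a = 2 * a' + 1" by (elim oddE)
    then have "\<not> spike_exponent a'"
      using less.prems spike_exponent_double by blast
    then obtain t where t: "2 ^ t \<le> a'" "sq_hits (a' - 2 ^ t) a'"
      using less.IH[of a'] a' by auto
    have "a - 2 ^ Suc t = 2 * (a' - 2 ^ t) + 1"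
      using t(1) a' by simp
    then have "sq_hits (a - 2 ^ Suc t) a"
      using t(2) sq_hits_odd_odd[of "a' - 2 ^ t" a'] by (simp only: a')
    then show ?thesis
      using t(1) a' by (intro exI[of _ "Suc t"]) auto
  qed
qed

lemma sq_hits_power_two:
  assumes "m \<ge> 2"
  shows "sq_hits (2 ^ m - 2) (2 ^ m)"
proof -
  obtain n where m: "m = Suc (Suc n)"
    using assms by (metis add_2_eq_Suc le_Suc_ex)
  have "sq_hits (2 ^ Suc n - 1) (2 ^ Suc n)"
    by (simp add: sq_hits_def)
  then show ?thesis
    unfolding m using sq_hits_even_even[of "2 ^ Suc n - 1" "2 ^ Suc n"]
    by (simp add: diff_mult_distrib2)
qed

lemma sq_hits_zero_left: "sq_hits 0 a \<longleftrightarrow> a = 0"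
  by (cases a) (auto simp: sq_hits_def)

section \<open>The entries of a row\<close>

lemma expos_add_single:
  assumes "a \<in> expos k n" and "l \<in> {1..k}"
  shows "a + Poly_Mapping.single l m \<in> expos k (n + m)"
proof -
  have "Poly_Mapping.keys (a + Poly_Mapping.single l m) \<subseteq> {1..k}"
    using assms keys_add[of a "Poly_Mapping.single l m"] by (auto simp: expos_def split: if_splits)
  moreover have "(\<Sum>i\<in>{1..k}. Poly_Mapping.lookup (a + Poly_Mapping.single l m) i) = n + m"
    using assms by (simp add: expos_def lookup_add sum.distrib lookup_single when_def)
  ultimately show ?thesis by (simp add: expos_def)
qed

lemma expos_minus_single:
  assumes "a \<in> expos k n" and "l \<in> {1..k}" and "m \<le> Poly_Mapping.lookup a l"
  shows "m \<le> n" and "a - Poly_Mapping.single l m \<in> expos k (n - m)"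
proof -
  define b where "b = a - Poly_Mapping.single l m"
  have a: "a = b + Poly_Mapping.single l m"
    using assms(3) by (intro poly_mapping_eqI)
      (auto simp: b_def lookup_add lookup_minus lookup_single when_def)
  have "n = (\<Sum>i\<in>{1..k}. Poly_Mapping.lookup b i) + m"
    using assms(1,2) unfolding a by (simp add: expos_def lookup_add sum.distrib lookup_single when_def)
  moreover have "Poly_Mapping.keys b \<subseteq> Poly_Mapping.keys a"
    unfolding a by (auto simp: in_keys_iff lookup_add)
  ultimately show "m \<le> n" and "a - Poly_Mapping.single l m \<in> expos k (n - m)"
    using assms(1) unfolding b_def[symmetric] by (auto simp: expos_def)
qed

text \<open>
  The degrees are matched by the hypotheses, so the exponents raised by \<open>Sq\<^sup>r\<close> automatically
  have sum \<open>r\<close>, and only the conditions on the individual exponents remain.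
\<close>

lemma lookup_Sq_xpow:
  assumes g: "g \<in> expos k m" and a: "a \<in> expos k (m + r)"
  shows "Poly_Mapping.lookup (Sq k r (xpow g)) a =
    of_bool (\<forall>l\<in>{1..k}. sq_hits (Poly_Mapping.lookup g l) (Poly_Mapping.lookup a l))"
proof -
  have "(\<exists>b\<in>expos k r. a = g + b \<and>
       (\<forall>i\<in>{1..k}. odd (Poly_Mapping.lookup g i choose Poly_Mapping.lookup b i)))
    \<longleftrightarrow> (\<forall>l\<in>{1..k}. sq_hits (Poly_Mapping.lookup g l) (Poly_Mapping.lookup a l))" (is "?l \<longleftrightarrow> ?r")
  proof
    assume ?l
    then show ?r by (auto simp: sq_hits_def lookup_add)
  next
    assume r: ?r
    define b where "b = a - g"
    have zero: "Poly_Mapping.lookup e l = 0" if "l \<notin> {1..k}" "e \<in> expos k n" for e l n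
      using that(1) expos_support[OF that(2)] by blast
    have ab: "a = g + b"
    proof (rule poly_mapping_eqI)
      fix l
      show "Poly_Mapping.lookup a l = Poly_Mapping.lookup (g + b) l"
        using r zero[OF _ a] zero[OF _ g]
        by (cases "l \<in> {1..k}") (auto simp: b_def lookup_add lookup_minus sq_hits_def)
    qed
    moreover have "b \<in> expos k r"
    proof -
      have "Poly_Mapping.keys b \<subseteq> Poly_Mapping.keys a"
        unfolding ab by (auto simp: in_keys_iff lookup_add)
      then show ?thesis
        using a g unfolding ab by (auto simp: expos_def lookup_add sum.distrib)
    qed
    moreover have "\<forall>i\<in>{1..k}. odd (Poly_Mapping.lookup g i choose Poly_Mapping.lookup b i)"
      using r by (auto simp: sq_hits_def b_def lookup_minus)
    ultimately show ?l by blast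
  qed
  then show ?thesis
    by (simp add: lookup_Sq xpow_def)
qed

definition even_support :: "nat \<Rightarrow> expo \<Rightarrow> nat set" where
  "even_support k c = {j \<in> {1..k}. even (Poly_Mapping.lookup c j) \<and> Poly_Mapping.lookup c j > 0}"

text \<open>
  For \<open>c = e + \<epsilon>\<^sub>i\<close>, these are the indices \<open>j\<close> for which \<open>x\<^sup>c\<close> is reached from \<open>x\<^sup>g\<close> through
  \<open>x\<^bsup>c - \<epsilon>\<^sub>j\<^esup>\<close>. The Steenrod square from \<open>x\<^sup>g\<close> to \<open>x\<^bsup>c - \<epsilon>\<^sub>j\<^esup>\<close> is determined by the degrees.
\<close>

definition contributors :: "nat \<Rightarrow> expo \<Rightarrow> expo \<Rightarrow> nat set" where
  "contributors k c g = {j \<in> even_support k c. \<forall>l\<in>{1..k}.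
     sq_hits (Poly_Mapping.lookup g l) (Poly_Mapping.lookup (c - Poly_Mapping.single j 1) l)}"

lemma M_entry_eq:
  assumes e: "e \<in> T k d" and tg: "(t, g) \<in> col_labels k d"
  shows "M_entry k e (t, g) =
    of_bool (odd (card (contributors k (e + Poly_Mapping.single (lead_index e) 1) g)))"
proof -
  define c where "c = e + Poly_Mapping.single (lead_index e) 1"
  have e': "e \<in> expos k d" "e \<noteq> 0" "odd (Poly_Mapping.lookup e (lead_index e))"
    using e by (auto simp: T_def)
  have lead: "lead_index e \<in> {1..k}"
    using lead_index_pos[OF e'(2)] by (intro expos_support[OF e'(1)]) simp
  have c: "c \<in> expos k (d + 1)"
    unfolding c_def by (rule expos_add_single[OF e'(1) lead])
  have g: "2 ^ t \<le> d" "g \<in> expos k (d - 2 ^ t)"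
    using tg by (auto simp: col_labels_def)
  have summand: "Poly_Mapping.lookup (Sq k (2 ^ t) (xpow g)) (c - Poly_Mapping.single j 1) =
      of_bool (j \<in> contributors k c g)" if j: "j \<in> even_support k c" for j
  proof -
    have "c - Poly_Mapping.single j 1 \<in> expos k ((d - 2 ^ t) + 2 ^ t)"
      using expos_minus_single(2)[OF c, of j 1] j g(1) by (auto simp: even_support_def)
    from lookup_Sq_xpow[OF g(2) this] show ?thesis
      using j by (simp add: contributors_def)
  qed
  have fin: "finite (even_support k c)"
    unfolding even_support_def by (rule finite_subset[of _ "{1..k}"]) auto
  have "M_entry k e (t, g) = Poly_Mapping.lookup (Sq k 1 (Sq k (2 ^ t) (xpow g))) c"
    by (simp add: M_entry_def p_def lookup_h[OF e'(2,3)] c_def)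
  also have "\<dots> = (\<Sum>j\<in>even_support k c.
      Poly_Mapping.lookup (Sq k (2 ^ t) (xpow g)) (c - Poly_Mapping.single j 1))"
    unfolding lookup_Sq_1 even_support_def by simp
  also have "\<dots> = (\<Sum>j\<in>even_support k c. of_bool (j \<in> contributors k c g))"
    by (intro sum.cong refl summand)
  also have "\<dots> = of_nat (card (even_support k c \<inter> {j. j \<in> contributors k c g}))"
    by (intro sum_of_bool_eq fin)
  also have "even_support k c \<inter> {j. j \<in> contributors k c g} = contributors k c g"
    by (auto simp: contributors_def)
  finally show ?thesis
    unfolding c_def[symmetric] of_nat_bit_eq_odd .
qed


lemma zero_row_iff:
  assumes "e \<in> T k d"
  shows "zero_row k d e \<longleftrightarrow> (\<forall>(t, g) \<in> col_labels k d.
    even (card (contributors k (e + Poly_Mapping.single (lead_index e) 1) g)))"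
  unfolding zero_row_def using M_entry_eq[OF assms] by (fastforce split: if_splits)

text \<open>
  A spike exponent is hit only by itself, and 2 only by 1 and 2. So at most the index \<open>q\<close>
  loses degree, and it loses at most one.
\<close>

lemma degree_le_of_sq_hits:
  assumes a: "a \<in> expos k n" and g: "g \<in> expos k m"
    and hits: "\<And>l. l \<in> {1..k} \<Longrightarrow> sq_hits (Poly_Mapping.lookup g l) (Poly_Mapping.lookup a l)"
    and spike: "\<And>l. l \<in> {1..k} \<Longrightarrow> l \<noteq> q \<Longrightarrow> spike_exponent (Poly_Mapping.lookup a l)"
    and q: "spike_exponent (Poly_Mapping.lookup a q) \<or> Poly_Mapping.lookup a q = 2"
  shows "n \<le> m + 1"
proof -
  have "Poly_Mapping.lookup a l \<le> Poly_Mapping.lookup g l + of_bool (l = q)" if l: "l \<in> {1..k}" for l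
  proof (cases "spike_exponent (Poly_Mapping.lookup a l)")
    case True
    then show ?thesis
      using sq_hits_spike[OF hits[OF l]] by simp
  next
    case False
    then have lq: "l = q" and "Poly_Mapping.lookup a l = 2"
      using spike[OF l] q by auto
    moreover have "Poly_Mapping.lookup g l \<noteq> 0"
      using hits[OF l] sq_hits_zero_left calculation(2) by (metis zero_neq_numeral)
    ultimately show ?thesis by simp
  qed
  then have "(\<Sum>l\<in>{1..k}. Poly_Mapping.lookup a l) \<le>
      (\<Sum>l\<in>{1..k}. Poly_Mapping.lookup g l + of_bool (l = q))"
    by (rule sum_mono)
  also have "\<dots> \<le> (\<Sum>l\<in>{1..k}. Poly_Mapping.lookup g l) + 1"
    by (simp add: sum.distrib of_bool_def)
  finally show ?thesis
    using a g by (simp add: expos_def)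
qed

section \<open>Zero rows\<close>

definition near_spike :: "nat \<Rightarrow> expo \<Rightarrow> nat \<Rightarrow> nat \<Rightarrow> bool" where
  "near_spike k e i j \<longleftrightarrow> Poly_Mapping.lookup e i = 1 \<and> i < j \<and> j \<le> k \<and>
     Poly_Mapping.lookup e j = 2 \<and> (\<forall>l\<in>{1..k} - {i, j}. spike_exponent (Poly_Mapping.lookup e l))"

lemma not_spike_exponent_two: "\<not> spike_exponent 2"
  using odd_spike_exponent[of 2] by auto

text \<open>
  Another index with exponent 2 would violate the condition on the remaining exponents,
  because 2 is not a spike exponent.
\<close>

lemma unique_two_iff_near_spike:
  "(Poly_Mapping.lookup e i = 1 \<and>
      (\<exists>j. {j' \<in> {1..k}. j' > i \<and> Poly_Mapping.lookup e j' = 2} = {j} \<and>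
         (\<forall>l\<in>{1..k} - {i, j}. spike_exponent (Poly_Mapping.lookup e l))))
   \<longleftrightarrow> (\<exists>j. near_spike k e i j)"
proof -
  have "{j' \<in> {1..k}. j' > i \<and> Poly_Mapping.lookup e j' = 2} = {j}"
    if j: "near_spike k e i j" for j
  proof -
    have "j' = j" if "j' \<in> {1..k}" "j' > i" "Poly_Mapping.lookup e j' = 2" for j'
      using j that not_spike_exponent_two unfolding near_spike_def
      by (metis DiffI insertE less_irrefl singletonD)
    moreover have "j \<in> {1..k}" "j > i" "Poly_Mapping.lookup e j = 2"
      using j by (auto simp: near_spike_def)
    ultimately show ?thesis by blast
  qed
  moreover have "i < j \<and> j \<le> k \<and> Poly_Mapping.lookup e j = 2"
    if "{j' \<in> {1..k}. j' > i \<and> Poly_Mapping.lookup e j' = 2} = {j}" for j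
    using that by auto
  ultimately show ?thesis
    unfolding near_spike_def by blast
qed

text \<open>
  A row \<open>x\<^sup>e\<close> with its leading index \<open>i\<close>, and the unique monomial \<open>x\<^sup>c\<close> that \<open>h\<close> sends to it.
\<close>

locale odd_leading_row =
  fixes k d :: nat and e c :: expo and i :: nat
  assumes e: "e \<in> T k d"
    and i_def: "i = lead_index e"
    and c_def: "c = e + Poly_Mapping.single i 1"
begin

lemma e_expos: "e \<in> expos k d"
  using e by (simp add: T_def)

lemma odd_e_i: "odd (Poly_Mapping.lookup e i)"
  using e by (simp add: T_def i_def)

lemma i_range: "i \<in> {1..k}"
  using odd_pos[OF odd_e_i] by (intro expos_support[OF e_expos]) simp

lemma e_below_i: "l < i \<Longrightarrow> Poly_Mapping.lookup e l = 0"
  unfolding i_def lead_index_def using not_less_Least by blast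

lemma c_i: "Poly_Mapping.lookup c i = Poly_Mapping.lookup e i + 1"
  by (simp add: c_def lookup_add)

lemma c_other: "l \<noteq> i \<Longrightarrow> Poly_Mapping.lookup c l = Poly_Mapping.lookup e l"
  by (simp add: c_def lookup_add lookup_single when_def)

lemma c_expos: "c \<in> expos k (d + 1)"
  unfolding c_def by (rule expos_add_single[OF e_expos i_range])

lemma i_even_support: "i \<in> even_support k c"
  using i_range odd_e_i odd_pos[OF odd_e_i] by (simp add: even_support_def c_i)

lemma c_minus_i: "c - Poly_Mapping.single i 1 = e"
  by (simp add: c_def)

lemma even_supportD:
  assumes "j \<in> even_support k c"
  shows "j \<in> {1..k}" "even (Poly_Mapping.lookup c j)" "Poly_Mapping.lookup c j \<ge> 2"
    "c - Poly_Mapping.single j 1 \<in> expos k d"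
proof -
  show j: "j \<in> {1..k}" "even (Poly_Mapping.lookup c j)" and "Poly_Mapping.lookup c j \<ge> 2"
    using assms by (auto simp: even_support_def elim!: evenE)
  then show "c - Poly_Mapping.single j 1 \<in> expos k d"
    using expos_minus_single(2)[OF c_expos j(1), of 1] by simp
qed

lemma zero_row_contributors:
  "zero_row k d e \<longleftrightarrow> (\<forall>(t, g) \<in> col_labels k d. even (card (contributors k c g)))"
  unfolding c_def i_def by (rule zero_row_iff[OF e])

text \<open>
  The columns lower the degree by \<open>2^t \<ge> 2\<close>, which is more than \<open>degree_le_of_sq_hits\<close> permits.
  This is where the absence of columns with \<open>t = 0\<close> matters.
\<close>

lemma zero_row_of_almost_spikes:
  assumes "\<And>j. j \<in> even_support k c \<Longrightarrow> \<exists>q.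
      (\<forall>l\<in>{1..k} - {q}. spike_exponent (Poly_Mapping.lookup (c - Poly_Mapping.single j 1) l)) \<and>
      (spike_exponent (Poly_Mapping.lookup (c - Poly_Mapping.single j 1) q) \<or>
       Poly_Mapping.lookup (c - Poly_Mapping.single j 1) q = 2)"
  shows "zero_row k d e"
proof -
  have "contributors k c g = {}" if tg: "(t, g) \<in> col_labels k d" for t g
  proof (rule ccontr)
    assume "contributors k c g \<noteq> {}"
    then obtain j where j: "j \<in> even_support k c" and hits: "\<And>l. l \<in> {1..k} \<Longrightarrow>
        sq_hits (Poly_Mapping.lookup g l) (Poly_Mapping.lookup (c - Poly_Mapping.single j 1) l)"
      by (auto simp: contributors_def)
    have tg': "t \<ge> 1" "2 ^ t \<le> d" "g \<in> expos k (d - 2 ^ t)"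
      using tg by (auto simp: col_labels_def)
    obtain q where q: "\<And>l. l \<in> {1..k} \<Longrightarrow> l \<noteq> q \<Longrightarrow>
        spike_exponent (Poly_Mapping.lookup (c - Poly_Mapping.single j 1) l)"
      "spike_exponent (Poly_Mapping.lookup (c - Poly_Mapping.single j 1) q) \<or>
       Poly_Mapping.lookup (c - Poly_Mapping.single j 1) q = 2"
      using assms[OF j] by blast
    have "d \<le> d - 2 ^ t + 1"
      by (rule degree_le_of_sq_hits[OF even_supportD(4)[OF j] tg'(3) hits q])
    moreover have "(2::nat) ^ 1 \<le> 2 ^ t"
      using tg'(1) by (intro power_increasing) auto
    ultimately show False using tg'(2) by simp
  qed
  then show ?thesis
    by (auto simp: zero_row_contributors)
qed

lemma even_support_spike:
  assumes "l \<in> even_support k c" and "l \<noteq> i"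
  shows "\<not> spike_exponent (Poly_Mapping.lookup e l)"
  using even_supportD[OF assms(1)] odd_spike_exponent[of "Poly_Mapping.lookup e l"]
    c_other[OF assms(2)] by auto

lemma zero_row_of_spike:
  assumes "spike k e"
  shows "zero_row k d e"
proof (rule zero_row_of_almost_spikes)
  fix j assume "j \<in> even_support k c"
  then have "j = i"
    using assms even_support_spike even_supportD(1) by (auto simp: spike_def)
  then show "\<exists>q. (\<forall>l\<in>{1..k} - {q}. spike_exponent (Poly_Mapping.lookup (c - Poly_Mapping.single j 1) l)) \<and>
      (spike_exponent (Poly_Mapping.lookup (c - Poly_Mapping.single j 1) q) \<or>
       Poly_Mapping.lookup (c - Poly_Mapping.single j 1) q = 2)"
    using assms i_range unfolding \<open>j = i\<close> c_minus_i by (auto simp: spike_def intro!: exI[of _ i])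
qed

lemma zero_row_of_near_spike:
  assumes "near_spike k e i m"
  shows "zero_row k d e"
proof (rule zero_row_of_almost_spikes)
  note m = assms[unfolded near_spike_def]
  fix j assume j: "j \<in> even_support k c"
  have "j = i \<or> j = m"
    using m even_support_spike[OF j] even_supportD(1)[OF j] by blast
  then show "\<exists>q. (\<forall>l\<in>{1..k} - {q}. spike_exponent (Poly_Mapping.lookup (c - Poly_Mapping.single j 1) l)) \<and>
      (spike_exponent (Poly_Mapping.lookup (c - Poly_Mapping.single j 1) q) \<or>
       Poly_Mapping.lookup (c - Poly_Mapping.single j 1) q = 2)"
  proof
    assume "j = i"
    then show ?thesis
      using m unfolding \<open>j = i\<close> c_minus_i
      by (intro exI[of _ m]) auto
  next
    assume "j = m"
    then show ?thesis
      using m unfolding \<open>j = m\<close>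
      by (intro exI[of _ i]) (auto simp: lookup_minus lookup_single when_def c_i c_other)
  qed
qed

text \<open>
  In the column \<open>g = c - \<epsilon>\<^sub>j - 2^t \<epsilon>\<^sub>l\<close>, an index \<open>r \<noteq> j\<close> cannot contribute. If \<open>r \<noteq> l\<close>, then \<open>g\<^sub>r\<close>
  exceeds the exponent \<open>c\<^sub>r - 1\<close> that it would have to hit; if \<open>r = l\<close>, the even exponent
  \<open>c\<^sub>l - 2^t\<close> would have to hit the odd exponent \<open>c\<^sub>l - 1\<close>. So the entry in this column is the
  contribution of \<open>j\<close> alone, and a zero row makes it vanish.
\<close>

lemma isolated_column:
  assumes row: "zero_row k d e" and j: "j \<in> even_support k c" and l: "l \<in> {1..k}" and t: "t \<ge> 1"
    and le: "2 ^ t \<le> Poly_Mapping.lookup (c - Poly_Mapping.single j 1) l"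
  shows "\<not> sq_hits (Poly_Mapping.lookup (c - Poly_Mapping.single j 1) l - 2 ^ t)
                  (Poly_Mapping.lookup (c - Poly_Mapping.single j 1) l)"
proof
  define a where "a = c - Poly_Mapping.single j 1"
  define g where "g = a - Poly_Mapping.single l (2 ^ t)"
  assume hit: "sq_hits (Poly_Mapping.lookup (c - Poly_Mapping.single j 1) l - 2 ^ t)
                  (Poly_Mapping.lookup (c - Poly_Mapping.single j 1) l)"
  have g_l: "Poly_Mapping.lookup g l = Poly_Mapping.lookup a l - 2 ^ t"
    by (simp add: g_def lookup_minus)
  have g_other: "Poly_Mapping.lookup g r = Poly_Mapping.lookup a r" if "r \<noteq> l" for r
    using that by (simp add: g_def lookup_minus lookup_single when_def)
  have "2 ^ t \<le> d" "g \<in> expos k (d - 2 ^ t)"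
    unfolding g_def a_def using expos_minus_single[OF even_supportD(4)[OF j] l le] by auto
  then have col: "(t, g) \<in> col_labels k d"
    using t by (auto simp: col_labels_def)
  have "contributors k c g = {j}"
  proof (intro equalityI subsetI)
    fix r assume "r \<in> contributors k c g"
    then have r: "r \<in> even_support k c" and hits: "sq_hits (Poly_Mapping.lookup g r)
        (Poly_Mapping.lookup (c - Poly_Mapping.single r 1) r)"
      by (auto simp: contributors_def even_support_def)
    have c_r: "Poly_Mapping.lookup (c - Poly_Mapping.single r 1) r = Poly_Mapping.lookup c r - 1"
      by (simp add: lookup_minus)
    show "r \<in> {j}"
    proof (rule ccontr)
      assume "r \<notin> {j}"
      then have a_r: "Poly_Mapping.lookup a r = Poly_Mapping.lookup c r"
        by (simp add: a_def lookup_minus lookup_single when_def)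
      show False
      proof (cases "r = l")
        case True
        have "even (Poly_Mapping.lookup g r)"
          using g_l a_r True even_supportD(2)[OF r] t by simp
        moreover have "odd (Poly_Mapping.lookup c r - 1)"
          using even_supportD(2,3)[OF r] by simp
        ultimately show False
          using hits not_sq_hits_even_odd unfolding c_r by blast
      next
        case False
        then have "Poly_Mapping.lookup g r > Poly_Mapping.lookup c r - 1"
          using g_other a_r even_supportD(3)[OF r] by simp
        then show False
          using hits unfolding c_r sq_hits_def by simp
      qed
    qed
  next
    fix r assume "r \<in> {j}"
    moreover have "sq_hits (Poly_Mapping.lookup g r) (Poly_Mapping.lookup a r)" for r
      using hit g_l g_other[of r] by (cases "r = l") (auto simp: a_def)
    ultimately show "r \<in> contributors k c g"
      using j by (simp add: contributors_def a_def)
  qed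
  then show False
    using row col by (auto simp: zero_row_contributors)
qed

text \<open>
  In the column that lowers all three exponents from 2 to 1, exactly these three indices
  contribute: after \<open>\<epsilon>\<^sub>r\<close> is subtracted, the other two exponents 2 are still hit by 1. The
  degree drops from \<open>d + 1\<close> to \<open>d - 2\<close>, so that \<open>Sq\<^sup>2\<close> links \<open>g\<close> to \<open>c - \<epsilon>\<^sub>r\<close>.
\<close>

lemma no_three_twos:
  assumes row: "zero_row k d e" and A: "A \<subseteq> even_support k c" "card A = 3"
    and two: "\<And>r. r \<in> A \<Longrightarrow> Poly_Mapping.lookup c r = 2"
  shows False
proof -
  obtain x y w where A_eq: "A = {x, y, w}" and dist: "x \<noteq> y" "y \<noteq> w" "x \<noteq> w"
    using A(2) by (auto simp: card_3_iff)
  define g where "g = c - Poly_Mapping.single x 1 - Poly_Mapping.single y 1 - Poly_Mapping.single w 1"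
  have g_lookup: "Poly_Mapping.lookup g r = (if r \<in> A then 1 else Poly_Mapping.lookup c r)" for r
    using dist two[of r] by (auto simp: g_def A_eq lookup_minus lookup_single when_def)
  have mem: "x \<in> even_support k c" "y \<in> even_support k c" "w \<in> even_support k c"
    using A(1) A_eq by auto
  have cx: "c - Poly_Mapping.single x 1 \<in> expos k d"
    by (rule even_supportD(4)[OF mem(1)])
  have cy: "1 \<le> d" "c - Poly_Mapping.single x 1 - Poly_Mapping.single y 1 \<in> expos k (d - 1)"
    using expos_minus_single[OF cx even_supportD(1)[OF mem(2)], of 1] dist two[of y] A_eq
    by (auto simp: lookup_minus lookup_single when_def)
  have "1 \<le> d - 1" "g \<in> expos k (d - 1 - 1)"
    unfolding g_def
    using expos_minus_single[OF cy(2) even_supportD(1)[OF mem(3)], of 1] dist two[of w] A_eq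
    by (auto simp: lookup_minus lookup_single when_def)
  then have col: "(1, g) \<in> col_labels k d"
    by (auto simp: col_labels_def numeral_2_eq_2)
  have hit_1_2: "sq_hits 1 2"
    by (simp add: sq_hits_def)
  have "contributors k c g = A"
  proof (intro equalityI subsetI)
    fix r assume "r \<in> contributors k c g"
    then have r: "r \<in> even_support k c" and hits: "sq_hits (Poly_Mapping.lookup g r)
        (Poly_Mapping.lookup (c - Poly_Mapping.single r 1) r)"
      by (auto simp: contributors_def even_support_def)
    have "Poly_Mapping.lookup g r \<noteq> Poly_Mapping.lookup c r"
      using hits even_supportD(3)[OF r] by (auto simp: sq_hits_def lookup_minus)
    then show "r \<in> A"
      using g_lookup by meson
  next
    fix r assume r: "r \<in> A"
    have "sq_hits (Poly_Mapping.lookup g l) (Poly_Mapping.lookup (c - Poly_Mapping.single r 1) l)" for l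
      using r two[of l] hit_1_2 by (auto simp: g_lookup lookup_minus lookup_single when_def)
    then show "r \<in> contributors k c g"
      using r A(1) by (auto simp: contributors_def)
  qed
  then show False
    using row col A(2) by (auto simp: zero_row_contributors)
qed

lemma zero_row_cases:
  assumes row: "zero_row k d e"
  shows "spike k e \<or> (\<exists>m. near_spike k e i m)"
proof -
  \<comment> \<open>An odd exponent that is not a spike exponent is hit from an even distance \<open>2^t\<close>, which an isolated column would detect.\<close>
  have isolated: "spike_exponent (Poly_Mapping.lookup (c - Poly_Mapping.single j 1) l)"
    if j: "j \<in> even_support k c" and l: "l \<in> {1..k}"
      and odd: "odd (Poly_Mapping.lookup (c - Poly_Mapping.single j 1) l)" for j l
    using exists_sq_hit isolated_column[OF row j l] odd by blast
  have off_support: "spike_exponent (Poly_Mapping.lookup e l)"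
    if "l \<in> {1..k}" "l \<notin> even_support k c" for l
  proof (cases "Poly_Mapping.lookup e l = 0")
    case False
    have "l \<noteq> i"
      using that i_even_support by auto
    then have "odd (Poly_Mapping.lookup e l)"
      using that False by (auto simp: even_support_def c_other)
    then show ?thesis
      using isolated[OF i_even_support that(1)] unfolding c_minus_i by blast
  qed simp
  have power: "\<exists>m. Poly_Mapping.lookup c j = 2 ^ m" if j: "j \<in> even_support k c" for j
  proof -
    have "spike_exponent (Poly_Mapping.lookup c j - 1)"
      using isolated[OF j even_supportD(1)[OF j]] even_supportD(2,3)[OF j]
      by (simp add: lookup_minus)
    then obtain m where "Poly_Mapping.lookup c j - 1 = 2 ^ m - 1"
      by (auto simp: spike_exponent_def)
    moreover have "(1::nat) \<le> 2 ^ m" by simp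
    ultimately have "Poly_Mapping.lookup c j = 2 ^ m"
      using even_supportD(3)[OF j] by linarith
    then show ?thesis ..
  qed
  have two: "Poly_Mapping.lookup c l = 2"
    if j: "j \<in> even_support k c" and l: "l \<in> even_support k c" and "j \<noteq> l" for j l
  proof (rule ccontr)
    assume ne: "Poly_Mapping.lookup c l \<noteq> 2"
    obtain m where m: "Poly_Mapping.lookup c l = 2 ^ m"
      using power[OF l] by blast
    \<comment> \<open>A power of 2 beyond 2 is hit from distance 2, and lowering \<open>c\<close> at \<open>j\<close> does not affect the exponent at \<open>l\<close>.\<close>
    have "m \<ge> 2"
      using ne even_supportD(3)[OF l] unfolding m by (cases m; cases "m - 1") auto
    moreover have "Poly_Mapping.lookup (c - Poly_Mapping.single j 1) l = 2 ^ m"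
      using \<open>j \<noteq> l\<close> by (simp add: lookup_minus lookup_single when_def m)
    ultimately show False
      using isolated_column[OF row j even_supportD(1)[OF l], of 1] sq_hits_power_two[of m]
        even_supportD(3)[OF l] m by simp
  qed
  show ?thesis
  proof (cases "even_support k c = {i}")
    case True
    have "spike_exponent (Poly_Mapping.lookup e i)"
      using isolated[OF i_even_support i_range] odd_e_i unfolding c_minus_i by blast
    then have "spike k e"
      unfolding spike_def using off_support True by (metis singletonD)
    then show ?thesis ..
  next
    case False
    then obtain m where m: "m \<in> even_support k c" "m \<noteq> i"
      using i_even_support by blast
    have all_two: "Poly_Mapping.lookup c r = 2" if "r \<in> even_support k c" for r
      using two[OF m(1) that] two[OF i_even_support that] m(2) by (cases "r = m") auto
    have sub: "even_support k c = {i, m}"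
    proof (rule ccontr)
      assume "even_support k c \<noteq> {i, m}"
      then obtain r where "r \<in> even_support k c" "r \<noteq> i" "r \<noteq> m"
        using m i_even_support by blast
      then have "{i, m, r} \<subseteq> even_support k c" "card {i, m, r} = 3"
        using m i_even_support by auto
      then show False
        using no_three_twos[OF row] all_two by blast
    qed
    have "Poly_Mapping.lookup e m = 2"
      using all_two[OF m(1)] c_other[OF m(2)] by simp
    moreover have "Poly_Mapping.lookup e i = 1"
      using all_two[OF i_even_support] c_i by simp
    moreover have "i < m"
      using e_below_i[of m] m(2) \<open>Poly_Mapping.lookup e m = 2\<close> by (metis linorder_neqE_nat zero_neq_numeral)
    moreover have "m \<le> k"
      using even_supportD(1)[OF m(1)] by simp
    ultimately have "near_spike k e i m"
      using off_support sub by (auto simp: near_spike_def)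
    then show ?thesis by blast
  qed
qed

end

theorem zero_row_characterization:
  assumes "e \<in> T k d"
  shows "zero_row k d e \<longleftrightarrow> spike k e \<or> (\<exists>j. near_spike k e (lead_index e) j)"
proof -
  interpret odd_leading_row k d e "e + Poly_Mapping.single (lead_index e) 1" "lead_index e"
    using assms by unfold_locales auto
  show ?thesis
    using zero_row_cases zero_row_of_spike zero_row_of_near_spike by blast
qed


section \<open>Counting the zero rows\<close>

definition spikes_on :: "nat set \<Rightarrow> nat \<Rightarrow> expo set" where
  "spikes_on A n = {b. Poly_Mapping.keys b \<subseteq> A \<and> (\<Sum>i\<in>A. Poly_Mapping.lookup b i) = n \<and>
     (\<forall>i\<in>A. spike_exponent (Poly_Mapping.lookup b i))}"

lemma S_eq_card_spikes_on: "S k (int n) = card (spikes_on {1..k} n)"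
  unfolding S_def spikes_on_def spike_def expos_def by (rule arg_cong[of _ _ card]) auto

lemma S_negative: "d < 0 \<Longrightarrow> S k d = 0"
  by (simp add: S_def)

text \<open>
  The pullback of an exponent vector along \<open>\<sigma>\<close>, cut off outside \<open>A\<close> so that \<open>\<sigma>\<close> has to be
  controlled on \<open>A\<close> only.
\<close>

definition reindex :: "(nat \<Rightarrow> nat) \<Rightarrow> nat set \<Rightarrow> expo \<Rightarrow> expo" where
  "reindex \<sigma> A b = (\<Sum>i\<in>A. Poly_Mapping.single i (Poly_Mapping.lookup b (\<sigma> i)))"

lemma lookup_reindex:
  assumes "finite A"
  shows "Poly_Mapping.lookup (reindex \<sigma> A b) i = (if i \<in> A then Poly_Mapping.lookup b (\<sigma> i) else 0)"
  using assms by (simp add: reindex_def lookup_sum lookup_single when_def)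

lemma reindex_spikes_on:
  assumes A: "finite A" and \<sigma>: "bij_betw \<sigma> A B" and b: "b \<in> spikes_on B n"
  shows "reindex \<sigma> A b \<in> spikes_on A n"
proof -
  have "Poly_Mapping.keys (reindex \<sigma> A b) \<subseteq> A"
    by (auto simp: in_keys_iff lookup_reindex[OF A] split: if_splits)
  moreover have "(\<Sum>i\<in>A. Poly_Mapping.lookup b (\<sigma> i)) = n"
    using sum.reindex_bij_betw[OF \<sigma>, of "Poly_Mapping.lookup b"] b by (simp add: spikes_on_def)
  moreover have "spike_exponent (Poly_Mapping.lookup b (\<sigma> i))" if "i \<in> A" for i
    using b bij_betwE[OF \<sigma>] that by (auto simp: spikes_on_def)
  ultimately show ?thesis
    by (simp add: spikes_on_def lookup_reindex[OF A])
qed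

lemma reindex_reindex:
  assumes A: "finite A" and B: "finite B" and \<sigma>: "\<And>i. i \<in> A \<Longrightarrow> \<sigma> i \<in> B \<and> \<tau> (\<sigma> i) = i"
    and keys: "Poly_Mapping.keys b \<subseteq> A"
  shows "reindex \<sigma> A (reindex \<tau> B b) = b"
proof (rule poly_mapping_eqI)
  fix i
  show "Poly_Mapping.lookup (reindex \<sigma> A (reindex \<tau> B b)) i = Poly_Mapping.lookup b i"
    using \<sigma>[of i] keys by (auto simp: lookup_reindex[OF A] lookup_reindex[OF B] in_keys_iff)
qed

lemma card_spikes_on_cong:
  assumes A: "finite A" and B: "finite B" and card: "card A = card B"
  shows "card (spikes_on A n) = card (spikes_on B n)"
proof -
  obtain \<sigma> where \<sigma>: "bij_betw \<sigma> A B"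
    using finite_same_card_bij[OF A B card] by blast
  define \<tau> where "\<tau> = inv_into A \<sigma>"
  have \<tau>: "bij_betw \<tau> B A"
    unfolding \<tau>_def by (rule bij_betw_inv_into[OF \<sigma>])
  have \<tau>\<sigma>: "\<sigma> i \<in> B \<and> \<tau> (\<sigma> i) = i" if "i \<in> A" for i
    unfolding \<tau>_def using that bij_betwE[OF \<sigma>] bij_betw_inv_into_left[OF \<sigma>] by blast
  have \<sigma>\<tau>: "\<tau> j \<in> A \<and> \<sigma> (\<tau> j) = j" if "j \<in> B" for j
    unfolding \<tau>_def using that bij_betwE[OF \<tau>] bij_betw_inv_into_right[OF \<sigma>] by (simp add: \<tau>_def)
  have "bij_betw (reindex \<tau> B) (spikes_on A n) (spikes_on B n)"
  proof (rule bij_betwI[where g = "reindex \<sigma> A"])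
    show "reindex \<sigma> A (reindex \<tau> B b) = b" if "b \<in> spikes_on A n" for b
      using that by (intro reindex_reindex A B \<tau>\<sigma>) (auto simp: spikes_on_def)
    show "reindex \<tau> B (reindex \<sigma> A b) = b" if "b \<in> spikes_on B n" for b
      using that by (intro reindex_reindex A B \<sigma>\<tau>) (auto simp: spikes_on_def)
  qed (use reindex_spikes_on[OF A \<sigma>] reindex_spikes_on[OF B \<tau>] in auto)
  then show ?thesis by (rule bij_betw_same_card)
qed

definition near_spikes :: "nat \<Rightarrow> nat \<Rightarrow> nat \<Rightarrow> nat \<Rightarrow> expo set" where
  "near_spikes k d i j = {e \<in> T k d. lead_index e = i \<and> near_spike k e i j}"

lemma near_spikesD:
  assumes "e \<in> near_spikes k d i j"
  shows "d \<ge> 3" and "1 \<le> i" and "i < j" and "j \<le> k"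
proof -
  have e: "e \<in> expos k d" and e': "Poly_Mapping.lookup e i = 1" "Poly_Mapping.lookup e j = 2" "i < j" "j \<le> k"
    using assms by (auto simp: near_spikes_def T_def near_spike_def)
  show "i < j" "j \<le> k" by (fact e')+
  show i: "1 \<le> i"
    using expos_support[OF e, of i] e'(1) by simp
  have "3 = (\<Sum>l\<in>{i, j}. Poly_Mapping.lookup e l)"
    using e' by simp
  also have "\<dots> \<le> (\<Sum>l\<in>{1..k}. Poly_Mapping.lookup e l)"
    using e' i by (intro sum_mono2) auto
  finally show "d \<ge> 3"
    using e by (simp add: expos_def)
qed

text \<open>
  Exponents before the leading index vanish, so after the entries 1 and 2 at \<open>i\<close> and \<open>j\<close> are
  removed, what is left lives on the variables after \<open>i\<close> other than \<open>j\<close>.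
\<close>

lemma bij_betw_near_spikes:
  assumes ij: "1 \<le> i" "i < j" "j \<le> k"
  shows "bij_betw (\<lambda>b. b + (Poly_Mapping.single i 1 + Poly_Mapping.single j 2))
    (spikes_on ({i<..k} - {j}) n) (near_spikes k (n + 3) i j)"
    (is "bij_betw _ (spikes_on ?A n) _")
proof -
  define v where "v = Poly_Mapping.single i 1 + Poly_Mapping.single j (2::nat)"
  have v: "Poly_Mapping.lookup v l = (if l = i then 1 else if l = j then 2 else 0)" for l
    using ij by (auto simp: v_def lookup_add lookup_single when_def)
  have range: "{1..k} = {1..<i} \<union> insert i (insert j ?A)"
    using ij by auto
  have fin: "finite ?A" and notin: "i \<notin> insert j ?A" "j \<notin> ?A" "{1..<i} \<inter> insert i (insert j ?A) = {}"
    using ij by auto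
  have split: "(\<Sum>l\<in>{1..k}. Poly_Mapping.lookup e l) = (\<Sum>l\<in>{1..<i}. Poly_Mapping.lookup e l) +
      Poly_Mapping.lookup e i + Poly_Mapping.lookup e j + (\<Sum>l\<in>?A. Poly_Mapping.lookup e l)" for e :: expo
  proof -
    have "(\<Sum>l\<in>{1..k}. Poly_Mapping.lookup e l) = (\<Sum>l\<in>{1..<i}. Poly_Mapping.lookup e l) +
        (\<Sum>l\<in>insert i (insert j ?A). Poly_Mapping.lookup e l)"
      unfolding range by (rule sum.union_disjoint[OF _ _ notin(3)]) auto
    also have "(\<Sum>l\<in>insert i (insert j ?A). Poly_Mapping.lookup e l) =
        Poly_Mapping.lookup e i + (\<Sum>l\<in>insert j ?A. Poly_Mapping.lookup e l)"
      by (rule sum.insert[OF _ notin(1)]) auto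
    also have "(\<Sum>l\<in>insert j ?A. Poly_Mapping.lookup e l) =
        Poly_Mapping.lookup e j + (\<Sum>l\<in>?A. Poly_Mapping.lookup e l)"
      by (rule sum.insert[OF fin notin(2)])
    finally show ?thesis by (simp only: add.assoc)
  qed
  show ?thesis
    unfolding v_def[symmetric]
  proof (rule bij_betwI[where g = "\<lambda>e. e - v"])
    show "(\<lambda>b. b + v) \<in> spikes_on ?A n \<rightarrow> near_spikes k (n + 3) i j"
    proof
      fix b assume "b \<in> spikes_on ?A n"
      then have keys: "Poly_Mapping.keys b \<subseteq> ?A" and sum: "(\<Sum>l\<in>?A. Poly_Mapping.lookup b l) = n"
        and spike: "\<And>l. l \<in> ?A \<Longrightarrow> spike_exponent (Poly_Mapping.lookup b l)"
        by (auto simp: spikes_on_def)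
      have b0: "Poly_Mapping.lookup b l = 0" if "l \<notin> ?A" for l
        using keys that by (metis in_keys_iff subsetD)
      define e where "e = b + v"
      have e: "Poly_Mapping.lookup e l =
          (if l = i then 1 else if l = j then 2 else Poly_Mapping.lookup b l)" for l
        using b0[of i] b0[of j] by (simp add: e_def lookup_add v)
      have "Poly_Mapping.keys e \<subseteq> {1..k}"
      proof
        fix l assume "l \<in> Poly_Mapping.keys e"
        then have "l = i \<or> l = j \<or> l \<in> ?A"
          using b0[of l] unfolding in_keys_iff e by presburger
        then show "l \<in> {1..k}" using ij by auto
      qed
      moreover have "(\<Sum>l\<in>{1..k}. Poly_Mapping.lookup e l) = n + 3"
      proof -
        have "(\<Sum>l\<in>?A. Poly_Mapping.lookup e l) = n"
          unfolding sum[symmetric] by (intro sum.cong) (auto simp: e)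
        moreover have "(\<Sum>l\<in>{1..<i}. Poly_Mapping.lookup e l) = 0"
          using ij b0 by (auto simp: e)
        ultimately show ?thesis
          unfolding split using ij by (simp add: e)
      qed
      ultimately have "e \<in> expos k (n + 3)"
        by (simp add: expos_def)
      moreover have lead: "lead_index e = i"
        unfolding lead_index_def
      proof (rule Least_equality)
        show "i \<le> l" if "0 < Poly_Mapping.lookup e l" for l
          using that ij b0[of l] by (cases "l < i") (auto simp: e)
      qed (simp add: e)
      moreover have "e \<noteq> 0"
        using e[of i] by auto
      moreover have "near_spike k e i j"
      proof -
        have "spike_exponent (Poly_Mapping.lookup b l)" for l
          using spike[of l] b0[of l] by (cases "l \<in> ?A") simp_all
        then show ?thesis
          unfolding near_spike_def using ij by (simp add: e)
      qed
      ultimately show "b + v \<in> near_spikes k (n + 3) i j"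
        unfolding e_def[symmetric] by (simp add: near_spikes_def T_def e)
    qed
    show "(\<lambda>e. e - v) \<in> near_spikes k (n + 3) i j \<rightarrow> spikes_on ?A n"
    proof
      fix e assume "e \<in> near_spikes k (n + 3) i j"
      then have expos: "e \<in> expos k (n + 3)" and lead: "lead_index e = i"
        and two: "near_spike k e i j"
        by (auto simp: near_spikes_def T_def)
      have below: "Poly_Mapping.lookup e l = 0" if "l < i" for l
        using that not_less_Least unfolding lead[symmetric] lead_index_def by blast
      have b: "Poly_Mapping.lookup (e - v) l =
          (if l = i \<or> l = j then 0 else Poly_Mapping.lookup e l)" for l
        using two by (simp add: lookup_minus v near_spike_def)
      have "Poly_Mapping.keys (e - v) \<subseteq> ?A"
      proof
        fix l assume "l \<in> Poly_Mapping.keys (e - v)"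
        then have l: "l \<noteq> i" "l \<noteq> j" "Poly_Mapping.lookup e l \<noteq> 0"
          by (auto simp: in_keys_iff b split: if_splits)
        then have "l \<in> {1..k}"
          by (intro expos_support[OF expos]) simp
        moreover have "\<not> l < i"
          using below[of l] l(3) by auto
        ultimately show "l \<in> ?A" using l by auto
      qed
      moreover have "(\<Sum>l\<in>?A. Poly_Mapping.lookup (e - v) l) = n"
      proof -
        have "(\<Sum>l\<in>?A. Poly_Mapping.lookup (e - v) l) = (\<Sum>l\<in>?A. Poly_Mapping.lookup e l)"
          by (intro sum.cong) (auto simp: b)
        moreover have "(\<Sum>l\<in>{1..<i}. Poly_Mapping.lookup e l) = 0"
          using below by simp
        ultimately show ?thesis
          using split[of e] expos two by (simp add: expos_def near_spike_def)
      qed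
      moreover have "spike_exponent (Poly_Mapping.lookup (e - v) l)" if "l \<in> ?A" for l
        using that two ij by (simp add: b near_spike_def)
      ultimately show "e - v \<in> spikes_on ?A n"
        by (simp add: spikes_on_def)
    qed
    show "b + v - v = b" for b
      by simp
    show "(e - v) + v = e" if "e \<in> near_spikes k (n + 3) i j" for e
      using that by (intro poly_mapping_eqI)
        (auto simp: lookup_add lookup_minus v near_spikes_def near_spike_def)
  qed
qed

lemma card_near_spikes:
  assumes ij: "1 \<le> i" "i < j" "j \<le> k"
  shows "card (near_spikes k d i j) = S (k - i - 1) (int d - 3)"
proof (cases "d \<ge> 3")
  case True
  define n where "n = d - 3"
  have d: "d = n + 3" using True by (simp add: n_def)
  have "card ({i<..k} - {j}) = card {1..k - i - 1}"
    using ij by simp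
  then have "card (spikes_on ({i<..k} - {j}) n) = card (spikes_on {1..k - i - 1} n)"
    by (intro card_spikes_on_cong) auto
  then show ?thesis
    using bij_betw_same_card[OF bij_betw_near_spikes[OF ij, of n]] S_eq_card_spikes_on[of "k - i - 1" n]
    by (simp add: d)
next
  case False
  then have "near_spikes k d i j = {}"
    using near_spikesD(1) by blast
  then show ?thesis
    using False by (simp add: S_negative)
qed

lemma spikes_in_T:
  assumes "d > 0"
  shows "{e \<in> T k d. spike k e} = spikes_on {1..k} d"
proof -
  have "e \<in> T k d" if e: "e \<in> expos k d" "spike k e" for e
  proof -
    have "e \<noteq> 0"
      using e assms by (auto simp: expos_def)
    then have pos: "Poly_Mapping.lookup e (lead_index e) > 0"
      by (rule lead_index_pos)
    then have "lead_index e \<in> {1..k}"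
      by (intro expos_support[OF e(1)]) simp
    then have "odd (Poly_Mapping.lookup e (lead_index e))"
      using e(2) pos odd_spike_exponent by (simp add: spike_def)
    then show ?thesis
      using e(1) \<open>e \<noteq> 0\<close> by (simp add: T_def)
  qed
  then show ?thesis
    by (auto simp: spikes_on_def spike_def expos_def T_def)
qed

lemma finite_T: "finite (T k d)"
  using finite_expos by (auto simp: T_def)

text \<open>
  The leading index determines \<open>i\<close>, and \<open>j\<close> is the only position of an exponent 2, so the
  sets are disjoint. Their sizes do not depend on \<open>j\<close>, which has \<open>k - i\<close> possible values.
\<close>

lemma card_Union_near_spikes:
  "card (\<Union>i\<in>{1..<k}. \<Union>j\<in>{i<..k}. near_spikes k d i j) =
     (\<Sum>r<k - 1. (r + 1) * S r (int d - 3))"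
proof -
  have fin: "finite (near_spikes k d i j)" for i j
    using finite_T by (auto simp: near_spikes_def)
  have inner: "card (\<Union>j\<in>{i<..k}. near_spikes k d i j) = (k - i) * S (k - i - 1) (int d - 3)"
    if i: "i \<in> {1..<k}" for i
  proof -
    have "near_spikes k d i j \<inter> near_spikes k d i j' = {}" if "j \<noteq> j'" for j j'
    proof (rule ccontr)
      assume "near_spikes k d i j \<inter> near_spikes k d i j' \<noteq> {}"
      then obtain e where "near_spike k e i j" "near_spike k e i j'"
        by (auto simp: near_spikes_def)
      then have "spike_exponent (Poly_Mapping.lookup e j')" "Poly_Mapping.lookup e j' = 2"
        using \<open>j \<noteq> j'\<close> unfolding near_spike_def by (fastforce, blast)
      then show False
        using not_spike_exponent_two by simp
    qed
    then have "card (\<Union>j\<in>{i<..k}. near_spikes k d i j) = (\<Sum>j\<in>{i<..k}. card (near_spikes k d i j))"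
      using fin by (intro card_UN_disjoint) auto
    also have "\<dots> = (\<Sum>j\<in>{i<..k}. S (k - i - 1) (int d - 3))"
      using i by (intro sum.cong refl card_near_spikes) auto
    finally show ?thesis by simp
  qed
  have "card (\<Union>i\<in>{1..<k}. \<Union>j\<in>{i<..k}. near_spikes k d i j) =
      (\<Sum>i\<in>{1..<k}. card (\<Union>j\<in>{i<..k}. near_spikes k d i j))"
    using fin by (intro card_UN_disjoint) (auto simp: near_spikes_def)
  also have "\<dots> = (\<Sum>i\<in>{1..<k}. (k - i) * S (k - i - 1) (int d - 3))"
    by (intro sum.cong refl inner)
  also have "\<dots> = (\<Sum>r<k - 1. (r + 1) * S r (int d - 3))"
    by (rule sum.reindex_bij_witness[of _ "\<lambda>r. k - 1 - r" "\<lambda>i. k - 1 - i"])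
      (auto simp: Suc_diff_Suc)
  finally show ?thesis .
qed

theorem card_zero_rows:
  assumes "d > 0"
  shows "z k d = S k (int d) + (\<Sum>r<k - 1. (r + 1) * S r (int d - 3))"
proof -
  let ?X = "\<Union>i\<in>{1..<k}. \<Union>j\<in>{i<..k}. near_spikes k d i j"
  have X: "?X = {e \<in> T k d. \<exists>j. near_spike k e (lead_index e) j}" (is "_ = ?Y")
  proof (intro equalityI subsetI)
    fix e assume "e \<in> ?Y"
    then obtain j where "e \<in> near_spikes k d (lead_index e) j"
      by (auto simp: near_spikes_def)
    then show "e \<in> ?X"
      using near_spikesD[of e k d "lead_index e" j] by fastforce
  qed (auto simp: near_spikes_def)
  have disj: "{e \<in> T k d. spike k e} \<inter> ?X = {}"
  proof -
    have "\<not> spike k e" if "near_spike k e i j" for e i j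
      using that not_spike_exponent_two by (auto simp: near_spike_def spike_def dest!: bspec[of _ _ j])
    then show ?thesis unfolding X by blast
  qed
  have "{e \<in> T k d. zero_row k d e} = {e \<in> T k d. spike k e} \<union> ?X"
    unfolding X using zero_row_characterization by blast
  then have "z k d = card {e \<in> T k d. spike k e} + card ?X"
    unfolding z_def using disj finite_T[of k d] X by (simp add: card_Un_disjoint)
  then show ?thesis
    by (simp only: spikes_in_T[OF assms] S_eq_card_spikes_on card_Union_near_spikes)
qed

theorem theorem5p3:
  fixes k d :: nat
  assumes "k \<ge> 1" and "d > 0"
  shows "(\<forall>e\<in>T k d. zero_row k d e \<longleftrightarrow>
            spike k e \<or>
            (Poly_Mapping.lookup e (lead_index e) = 1 \<and>
             (\<exists>j. {j' \<in> {1..k}. j' > lead_index e \<and> Poly_Mapping.lookup e j' = 2} = {j} \<and>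
                  (\<forall>l\<in>{1..k} - {lead_index e, j}. spike_exponent (Poly_Mapping.lookup e l)))))
         \<and> z k d = S k (int d) + (\<Sum>r<k - 1. (r + 1) * S r (int d - 3))"
  unfolding unique_two_iff_near_spike
  using zero_row_characterization card_zero_rows[OF assms(2)] by blast

end
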